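(* If $\Gamma$ is a sequent derivable in $\mathsf{MLL}_{SC}$, then $$\big(n^-_{\otimes}(\Gamma)+n^+_{\wp}(\Gamma)+n_{co}(\Gamma)\big)-\big(n^+_{\otimes}(\Gamma)+n^-_{\wp}(\Gamma)\big)=1.$$
   Context: $\wp$ denotes par and $\otimes$ tensor. Formulae are built from atoms and negated atoms using $\otimes,\wp$, with $\overline{A\otimes B}=\overline{A}\wp\overline{B}$, $\overline{A\wp B}=\overline{A}\otimes\overline{B}$, $\overline{\overline{A}}=A$. A sequent is a finite list $\vdash A_1,\dots,A_n$. The one-sided sequent calculus $\mathsf{MLL}_{SC}$ has the rules: $\mathsf{id}$: $\vdash\overline{A},A$ (no premise); $\mathsf{exch}$: from $\vdash\Gamma,A,B,\Delta$ infer $\vdash\Gamma,B,A,\Delta$; $\wp$: from $\vdash\Gamma,A,B,\Delta$ infer $\vdash\Gamma,A\wp B,\Delta$; $\otimes$: from $\vdash\Gamma,A$ and $\vdash B,\Delta$ infer $\vdash\Gamma,A\otimes B,\Delta$; $\mathsf{cut}$: from $\vdash\Gamma,A$ and $\vdash\overline{A},\Delta$ infer $\vdash\Gamma,\Delta$. A connective occurrence occurs positively if the number of negation overlines above it is even, negatively otherwise (formulas may be read as expressions with overlines, equivalent up to the DeMorgan laws). For a sequent $\Gamma=A_1,\dots,A_n$, $n^{\pm}_{\otimes}(\Gamma)=\sum_i n^{\pm}_{\otimes}(A_i)$ and $n^{\pm}_{\wp}(\Gamma)=\sum_i n^{\pm}_{\wp}(A_i)$, where $n^{+}_{\otimes}(A)$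 counts positive occurrences of $\otimes$ in $A$ etc.; $n_{co}(\Gamma)$ is the number of commas in $\Gamma$. *)

theory Defs
  imports Main
begin

datatype 'a formula =
    Atom 'a
  | NAtom 'a
  | Tensor "'a formula" "'a formula"  (infixr \<open>\<otimes>\<close> 70)
  | Par "'a formula" "'a formula"  (infixr \<open>\<Parr>\<close> 65)

primrec dual :: "'a formula \<Rightarrow> 'a formula" where
  "dual (Atom a) = NAtom a"
| "dual (NAtom a) = Atom a"
| "dual (A \<otimes> B) = dual A \<Parr> dual B"
| "dual (A \<Parr> B) = dual A \<otimes> dual B"

lemma dual_dual [simp]: "dual (dual A) = A"
  by (induction A) simp_all

inductive MLL_SC :: "'a formula list \<Rightarrow> bool" (\<open>(\<turnstile> _)\<close> [50] 50) where
  id: "\<turnstile> [dual A, A]"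
| exch: "\<turnstile> \<Gamma> @ [A, B] @ \<Delta> \<Longrightarrow> \<turnstile> \<Gamma> @ [B, A] @ \<Delta>"
| par: "\<turnstile> \<Gamma> @ [A, B] @ \<Delta> \<Longrightarrow> \<turnstile> \<Gamma> @ [A \<Parr> B] @ \<Delta>"
| tensor: "\<turnstile> \<Gamma> @ [A] \<Longrightarrow> \<turnstile> [B] @ \<Delta> \<Longrightarrow> \<turnstile> \<Gamma> @ [A \<otimes> B] @ \<Delta>"
| cut: "\<turnstile> \<Gamma> @ [A] \<Longrightarrow> \<turnstile> [dual A] @ \<Delta> \<Longrightarrow> \<turnstile> \<Gamma> @ \<Delta>"

text \<open>
  In \<open>'a formula\<close> negation is a defined operation, so every connective occurrence is positive.
  Polarity of occurrences is a property of expressions with explicit overlines. Such an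
  expression is a way of writing the formula obtained by reading each overline as \<open>dual\<close>; two
  expressions write the same formula iff they are equal up to the De Morgan laws
  (\<open>formula_of_eq_iff\<close> below).
\<close>

datatype 'a expr =
    EAtom 'a
  | ENeg "'a expr"
  | ETensor "'a expr" "'a expr"
  | EPar "'a expr" "'a expr"

primrec formula_of :: "'a expr \<Rightarrow> 'a formula" where
  "formula_of (EAtom a) = Atom a"
| "formula_of (ENeg A) = dual (formula_of A)"
| "formula_of (ETensor A B) = formula_of A \<otimes> formula_of B"
| "formula_of (EPar A B) = formula_of A \<Parr> formula_of B"

inductive demorgan_eq :: "'a expr \<Rightarrow> 'a expr \<Rightarrow> bool" where
  dm_tensor: "demorgan_eq (ENeg (ETensor A B)) (EPar (ENeg A) (ENeg B))"
| dm_par: "demorgan_eq (ENeg (EPar A B)) (ETensor (ENeg A) (ENeg B))"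
| dm_neg: "demorgan_eq (ENeg (ENeg A)) A"
| refl: "demorgan_eq A A"
| sym: "demorgan_eq A B \<Longrightarrow> demorgan_eq B A"
| trans: "demorgan_eq A B \<Longrightarrow> demorgan_eq B C \<Longrightarrow> demorgan_eq A C"
| cong_neg: "demorgan_eq A A' \<Longrightarrow> demorgan_eq (ENeg A) (ENeg A')"
| cong_tensor: "demorgan_eq A A' \<Longrightarrow> demorgan_eq B B' \<Longrightarrow> demorgan_eq (ETensor A B) (ETensor A' B')"
| cong_par: "demorgan_eq A A' \<Longrightarrow> demorgan_eq B B' \<Longrightarrow> demorgan_eq (EPar A B) (EPar A' B')"

primrec expr_of :: "'a formula \<Rightarrow> 'a expr" where
  "expr_of (Atom a) = EAtom a"
| "expr_of (NAtom a) = ENeg (EAtom a)"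
| "expr_of (A \<otimes> B) = ETensor (expr_of A) (expr_of B)"
| "expr_of (A \<Parr> B) = EPar (expr_of A) (expr_of B)"

lemma formula_of_expr_of: "formula_of (expr_of A) = A"
  by (induction A) simp_all

lemma demorgan_eq_expr_of_dual: "demorgan_eq (ENeg (expr_of A)) (expr_of (dual A))"
proof (induction A)
  case (Tensor A B)
  then show ?case
    using demorgan_eq.trans[OF dm_tensor cong_par] by auto
next
  case (Par A B)
  then show ?case
    using demorgan_eq.trans[OF dm_par cong_tensor] by auto
qed (auto intro: demorgan_eq.intros(3,4))

lemma demorgan_eq_expr_of_formula_of: "demorgan_eq A (expr_of (formula_of A))"
proof (induction A)
  case (ENeg A)
  then show ?case
    using demorgan_eq.trans[OF cong_neg demorgan_eq_expr_of_dual] by auto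
qed (auto intro: demorgan_eq.refl cong_tensor cong_par)

lemma formula_of_eq_iff: "formula_of A = formula_of B \<longleftrightarrow> demorgan_eq A B"
proof
  assume "formula_of A = formula_of B"
  then show "demorgan_eq A B"
    by (metis demorgan_eq_expr_of_formula_of demorgan_eq.sym demorgan_eq.trans)
next
  assume "demorgan_eq A B"
  then show "formula_of A = formula_of B"
    by (induction rule: demorgan_eq.induct) simp_all
qed

datatype polarity = Pos | Neg

primrec flip :: "polarity \<Rightarrow> polarity" where
  "flip Pos = Neg"
| "flip Neg = Pos"

primrec n_tensor :: "'a expr \<Rightarrow> polarity \<Rightarrow> nat" where
  "n_tensor (EAtom a) p = 0"
| "n_tensor (ENeg A) p = n_tensor A (flip p)"
| "n_tensor (ETensor A B) p = of_bool (p = Pos) + n_tensor A p + n_tensor B p"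
| "n_tensor (EPar A B) p = n_tensor A p + n_tensor B p"

primrec n_par :: "'a expr \<Rightarrow> polarity \<Rightarrow> nat" where
  "n_par (EAtom a) p = 0"
| "n_par (ENeg A) p = n_par A (flip p)"
| "n_par (ETensor A B) p = n_par A p + n_par B p"
| "n_par (EPar A B) p = of_bool (p = Pos) + n_par A p + n_par B p"

definition seq_tensor :: "'a expr list \<Rightarrow> polarity \<Rightarrow> nat" where
  "seq_tensor \<Gamma> p = (\<Sum>A\<leftarrow>\<Gamma>. n_tensor A p)"

definition seq_par :: "'a expr list \<Rightarrow> polarity \<Rightarrow> nat" where
  "seq_par \<Gamma> p = (\<Sum>A\<leftarrow>\<Gamma>. n_par A p)"

text \<open>Truncated subtraction: the empty list has no commas.\<close>

definition n_co :: "'a list \<Rightarrow> nat" where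
  "n_co \<Gamma> = length \<Gamma> - 1"

end

theory Submission
  imports Defs
begin

text \<open>
  Weigh each par by \<open>1\<close> and each tensor by \<open>-1\<close>. Duality negates the weight, so the weight of an
  expression with overlines, with signs taken according to polarity, depends only on the formula
  it writes. The weight of a sequent plus its length is \<open>2\<close> for every derivable sequent: this holds
  for axioms, is preserved by the unary rules, and the binary rules combine two premises and lose
  \<open>2\<close> from the sum of their values.
\<close>

primrec weight :: "'a formula \<Rightarrow> int" where
  "weight (Atom a) = 0"
| "weight (NAtom a) = 0"
| "weight (A \<otimes> B) = weight A + weight B - 1"
| "weight (A \<Parr> B) = weight A + weight B + 1"

lemma weight_dual [simp]: "weight (dual A) = - weight A"
  by (induction A) simp_all

text \<open>An overline swaps the \<open>Pos\<close> and \<open>Neg\<close> counts, hence flips the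
  sign of the right side, just as \<open>dual\<close> does to \<open>weight\<close>.\<close>

lemma weight_formula_of:
  "weight (formula_of A) =
    int (n_tensor A Neg) + int (n_par A Pos) - int (n_tensor A Pos) - int (n_par A Neg)"
  by (induction A) simp_all

lemma sum_weight_formula_of:
  "(\<Sum>A\<leftarrow>\<Gamma>. weight (formula_of A)) =
    int (seq_tensor \<Gamma> Neg) + int (seq_par \<Gamma> Pos) - int (seq_tensor \<Gamma> Pos) - int (seq_par \<Gamma> Neg)"
  by (induction \<Gamma>) (simp_all add: seq_tensor_def seq_par_def weight_formula_of)

text \<open>In \<open>par\<close> the lost comma is offset by the new connective's weight 1. In
  \<open>tensor\<close> the length drops by one and the new connective weighs -1; in
  \<open>cut\<close> the weights of \<open>A\<close> and \<open>dual A\<close> cancel and the length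
  drops by two.\<close>

lemma derivable_weight:
  assumes "\<turnstile> \<Gamma>"
  shows "(\<Sum>A\<leftarrow>\<Gamma>. weight A) + int (length \<Gamma>) = 2"
  using assms by induction simp_all

theorem theorem3p6:
  fixes \<Gamma> :: "'a expr list"
  assumes "\<turnstile> map formula_of \<Gamma>"
  shows "(int (seq_tensor \<Gamma> Neg) + int (seq_par \<Gamma> Pos) + int (n_co \<Gamma>))
         - (int (seq_tensor \<Gamma> Pos) + int (seq_par \<Gamma> Neg)) = 1"
proof -
  have sum: "(\<Sum>A\<leftarrow>\<Gamma>. weight (formula_of A)) + int (length \<Gamma>) = 2"
    using derivable_weight[OF assms] by (simp add: comp_def)
  \<comment> \<open>An empty sequent would give 0 = 2; nonemptiness makes the truncated subtraction
    in \<open>n_co\<close> exact.\<close>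
  then have "\<Gamma> \<noteq> []"
    by auto
  then have "int (n_co \<Gamma>) = int (length \<Gamma>) - 1"
    by (cases \<Gamma>) (simp_all add: n_co_def)
  with sum show ?thesis
    by (simp add: sum_weight_formula_of)
qed

end
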